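(* Let $p$ be a prime, let $\theta : \mathbb{Z} \to Aut(\mathbb{Z}[1/p]^2)$ be a homomorphism, and let $M \in GL_2(\mathbb{Z}[1/p])$ be the matrix of $\theta(1)$. Then the Reidemeister spectrum of $\mathbb{Z}[1/p]^2 \rtimes_\theta \mathbb{Z}$ is $\{\infty\}$ if and only if there is no $2 \times 2$ matrix $N$ invertible over $\mathbb{Z}[1/p]$ such that $N = MNM$ and both $\det(Id - N)$ and $\det(Id - MN)$ are nonzero.
   Context: For an automorphism $\phi$ of a group $G$, the Reidemeister (twisted conjugacy) classes of $\phi$ are the equivalence classes of the relation $x \sim g x \phi(g^{-1})$, $x, g \in G$, and the Reidemeister number $R(\phi)$ is the number of these classes (a positive integer or $\infty$). The Reidemeister spectrum is $Spec(G) = \{R(\phi) \mid \phi \in Aut(G)\} \subseteq \mathbb{N} \cup \{\infty\}$. $\mathbb{Z}[1/p]$ denotes the subring of $\mathbb{Q}$ generated by $1/p$, and also its additive group; automorphisms of the additive group $\mathbb{Z}[1/p]^2$ are exactly the $\mathbb{Z}[1/p]$-linear ones. $\mathbb{Z}[1/p]^2 \rtimes_\theta \mathbb{Z}$ is the semidirect product in which the generator $1 \in \mathbb{Z}$ acts on $\mathbb{Z}[1/p]^2$ by $\theta(1)$. $Id$ is the identity matrix. *)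

theory Defs
  imports
    "HOL-Analysis.Analysis"
    "HOL-Algebra.Algebra"
    "HOL-Algebra.Algebraic_Closure_Type"
    "HOL-Library.Extended_Nat"
begin

definition reidemeister_rel :: "('a, 'b) monoid_scheme \<Rightarrow> ('a \<Rightarrow> 'a) \<Rightarrow> ('a \<times> 'a) set" where
  "reidemeister_rel G \<phi> =
     {(x, y). x \<in> carrier G \<and> y \<in> carrier G \<and>
        (\<exists>g\<in>carrier G. y = g \<otimes>\<^bsub>G\<^esub> x \<otimes>\<^bsub>G\<^esub> \<phi> (inv\<^bsub>G\<^esub> g))}"

definition reidemeister_classes :: "('a, 'b) monoid_scheme \<Rightarrow> ('a \<Rightarrow> 'a) \<Rightarrow> 'a set set" where
  "reidemeister_classes G \<phi> = carrier G // reidemeister_rel G \<phi>"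

definition reidemeister_number :: "('a, 'b) monoid_scheme \<Rightarrow> ('a \<Rightarrow> 'a) \<Rightarrow> enat" where
  "reidemeister_number G \<phi> =
     (if finite (reidemeister_classes G \<phi>) then enat (card (reidemeister_classes G \<phi>)) else \<infinity>)"

(* Elements of auto G are extensional (undefined outside the carrier of G). *)
definition reidemeister_spectrum :: "('a, 'b) monoid_scheme \<Rightarrow> enat set" where
  "reidemeister_spectrum G = {reidemeister_number G \<phi> | \<phi>. \<phi> \<in> auto G}"

definition semidirect_product ::
  "('a, 'c) monoid_scheme \<Rightarrow> ('b, 'd) monoid_scheme \<Rightarrow> ('b \<Rightarrow> 'a \<Rightarrow> 'a) \<Rightarrow> ('a \<times> 'b) monoid" where
  "semidirect_product A H \<theta> =
     \<lparr>carrier = carrier A \<times> carrier H,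
      monoid.mult = (\<lambda>(a, h) (b, k). (a \<otimes>\<^bsub>A\<^esub> \<theta> h b, h \<otimes>\<^bsub>H\<^esub> k)),
      one = (\<one>\<^bsub>A\<^esub>, \<one>\<^bsub>H\<^esub>)\<rparr>"

(* The subring of the rationals generated by 1/p. *)
definition Z_inv :: "nat \<Rightarrow> rat set" where
  "Z_inv p = generate_ring ring_of_type_algebra {1 / of_nat p}"

(* Additive group, written with the multiplicative monoid record of HOL-Algebra. *)
definition Z_inv_sq :: "nat \<Rightarrow> (rat ^ 2) monoid" where
  "Z_inv_sq p = \<lparr>carrier = {v. \<forall>i. v $ i \<in> Z_inv p}, monoid.mult = (+), one = 0\<rparr>"

definition Mat2_Z_inv :: "nat \<Rightarrow> (rat ^ 2 ^ 2) set" where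
  "Mat2_Z_inv p = {A. \<forall>i j. A $ i $ j \<in> Z_inv p}"

definition GL2_Z_inv :: "nat \<Rightarrow> (rat ^ 2 ^ 2) set" where
  "GL2_Z_inv p =
     {A \<in> Mat2_Z_inv p. \<exists>B\<in>Mat2_Z_inv p. A ** B = mat 1 \<and> B ** A = mat 1}"

end

theory Submission
  imports Defs "HOL-Number_Theory.Cong"
begin

text \<open>
  Write \<open>A = Z[1/p]\<^sup>2\<close> and \<open>G = A \<rtimes> Z\<close>. Since \<open>A\<close> is \<open>p\<close>-divisible and \<open>Z\<close> is not,
  every automorphism \<open>\<phi>\<close> of \<open>G\<close> restricts to a matrix \<open>N\<close> on \<open>A\<close> and induces \<open>e = \<plusminus> 1\<close> on
  the quotient \<open>Z\<close>. If \<open>e = 1\<close>, the projection to \<open>Z\<close> separates infinitely many classes. If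
  \<open>e = -1\<close>, then \<open>N = MNM\<close>, every class meets \<open>A \<times> {0, 1}\<close>, and the classes meeting \<open>A \<times> {0}\<close>
  and \<open>A \<times> {1}\<close> correspond to the cokernels of \<open>1 - N\<close> and \<open>1 - MN\<close>, which are finite exactly
  when the determinants do not vanish. Conversely, each \<open>N = MNM\<close> gives the automorphism
  \<open>(a, k) \<mapsto> (N a, -k)\<close>.
\<close>

section \<open>Arithmetic of the ring Z[1/p]\<close>

no_notation fps_nth (infixl "$" 75)

text \<open>Fractions over powers of \<open>p\<close> include \<open>1 / p\<close> and are stable
  under the ring operations; conversely each of them is an integer times a power of
  \<open>1 / p\<close>.\<close>

lemma Z_inv_eq:
  assumes "p > 0"
  shows "Z_inv p = {of_int a / of_nat p ^ n | a n. True}" (is "_ = ?F")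
proof
  interpret ring "ring_of_type_algebra :: rat ring" ..
  \<comment> \<open>\<open>generate_ring\<close> uses the additive inverse of the ring record, which
    is given by a description; uniqueness of inverses identifies it with the usual minus.\<close>
  have minus: "\<ominus>\<^bsub>ring_of_type_algebra\<^esub> x = - x" for x :: rat
    by (rule minus_equality) (auto simp: ring_of_type_algebra_def)
  show "Z_inv p \<subseteq> ?F"
  proof
    fix x assume "x \<in> Z_inv p"
    then show "x \<in> ?F"
      unfolding Z_inv_def
    proof (induction rule: generate_ring.induct)
      case one
      show ?case by (auto simp: ring_of_type_algebra_def intro!: exI[of _ 1] exI[of _ "0::nat"])
    next
      case (incl h)
      then show ?case by (auto intro!: exI[of _ 1] exI[of _ "1::nat"])
    next
      case (a_inv h)
      then obtain a n where "h = of_int a / of_nat p ^ n" by blast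
      then show ?case
        by (auto simp: minus intro!: exI[of _ "-a"] exI[of _ n])
    next
      case (eng_add h1 h2)
      then obtain a n b m where "h1 = of_int a / of_nat p ^ n" "h2 = of_int b / of_nat p ^ m" by blast
      then have "h1 + h2 = of_int (a * int p ^ m + b * int p ^ n) / of_nat p ^ (n + m)"
        using assms by (simp add: add_frac_eq power_add)
      then show ?case by (simp only: ring_of_type_algebra_def ring.simps) blast
    next
      case (eng_mult h1 h2)
      then obtain a n b m where "h1 = of_int a / of_nat p ^ n" "h2 = of_int b / of_nat p ^ m" by blast
      then have "h1 * h2 = of_int (a * b) / of_nat p ^ (n + m)"
        by (simp add: power_add)
      then show ?case by (simp only: ring_of_type_algebra_def monoid.simps) blast
    qed
  qed
  show "?F \<subseteq> Z_inv p"
  proof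
    have add: "x + y \<in> Z_inv p" if "x \<in> Z_inv p" "y \<in> Z_inv p" for x y
      using generate_ring.eng_add[OF that[unfolded Z_inv_def]] by (simp add: Z_inv_def ring_of_type_algebra_def)
    have mult: "x * y \<in> Z_inv p" if "x \<in> Z_inv p" "y \<in> Z_inv p" for x y
      using generate_ring.eng_mult[OF that[unfolded Z_inv_def]] by (simp add: Z_inv_def ring_of_type_algebra_def)
    have uminus: "- x \<in> Z_inv p" if "x \<in> Z_inv p" for x
      using generate_ring.a_inv[OF that[unfolded Z_inv_def]] by (simp add: Z_inv_def minus)
    have one: "1 \<in> Z_inv p"
      using generate_ring.one[of "ring_of_type_algebra :: rat ring"] by (simp add: Z_inv_def ring_of_type_algebra_def)
    have gen: "1 / of_nat p \<in> Z_inv p"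
      unfolding Z_inv_def by (rule generate_ring.incl) simp
    have "1 / of_nat p ^ n \<in> Z_inv p" for n
    proof (induction n)
      case (Suc n)
      from mult[OF gen Suc] show ?case by simp
    qed (simp add: one)
    moreover have nat: "of_nat k \<in> Z_inv p" for k
    proof (induction k)
      case 0
      from add[OF one uminus[OF one]] show ?case by simp
    qed (auto intro: add one)
    have "of_int a \<in> Z_inv p" for a
      by (cases a rule: int_cases2) (auto intro: nat uminus)
    ultimately have "of_int a * (1 / of_nat p ^ n) \<in> Z_inv p" for a n
      by (blast intro: mult)
    then show "x \<in> Z_inv p" if "x \<in> ?F" for x using that by auto
  qed
qed

locale Z_inv_ring =
  fixes p :: nat
  assumes p_pos: "p > 0"
begin

lemma Z_invE:
  assumes "x \<in> Z_inv p"
  obtains a n where "x = of_int a / of_nat p ^ n"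
  using assms by (auto simp: Z_inv_eq[OF p_pos])

lemma Z_inv_fraction: "of_int a / of_nat p ^ n \<in> Z_inv p"
  by (auto simp: Z_inv_eq[OF p_pos])

lemma Z_inv_of_int: "of_int a \<in> Z_inv p"
  using Z_inv_fraction[of a 0] by simp

lemma Z_inv_0: "0 \<in> Z_inv p" and Z_inv_1: "1 \<in> Z_inv p"
  using Z_inv_of_int[of 0] Z_inv_of_int[of 1] by auto

lemma Z_inv_mult:
  assumes "x \<in> Z_inv p" "y \<in> Z_inv p"
  shows "x * y \<in> Z_inv p"
proof -
  from assms obtain a n b m where "x = of_int a / of_nat p ^ n" "y = of_int b / of_nat p ^ m"
    by (meson Z_invE)
  then have "x * y = of_int (a * b) / of_nat p ^ (n + m)"
    by (simp add: power_add)
  then show ?thesis by (simp only: Z_inv_fraction)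
qed

lemma Z_inv_add:
  assumes "x \<in> Z_inv p" "y \<in> Z_inv p"
  shows "x + y \<in> Z_inv p"
proof -
  from assms obtain a n b m where "x = of_int a / of_nat p ^ n" "y = of_int b / of_nat p ^ m"
    by (meson Z_invE)
  then have "x + y = of_int (a * int p ^ m + b * int p ^ n) / of_nat p ^ (n + m)"
    using p_pos by (simp add: add_frac_eq power_add)
  then show ?thesis by (simp only: Z_inv_fraction)
qed

lemma Z_inv_uminus: "x \<in> Z_inv p \<Longrightarrow> - x \<in> Z_inv p"
  using Z_inv_mult[OF Z_inv_of_int[of "-1"]] by simp

lemma Z_inv_diff: "x \<in> Z_inv p \<Longrightarrow> y \<in> Z_inv p \<Longrightarrow> x - y \<in> Z_inv p"
  using Z_inv_add[OF _ Z_inv_uminus] by fastforce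

lemmas Z_inv_closed = Z_inv_0 Z_inv_1 Z_inv_add Z_inv_mult Z_inv_uminus Z_inv_diff

section \<open>The module Z[1/p]^2, its matrices and their cokernels\<close>

abbreviation "A \<equiv> carrier (Z_inv_sq p)"

lemma A_iff: "v \<in> A \<longleftrightarrow> v $ 1 \<in> Z_inv p \<and> v $ 2 \<in> Z_inv p"
  by (simp add: Z_inv_sq_def forall_2)

lemma Mat2_iff:
  "B \<in> Mat2_Z_inv p \<longleftrightarrow>
    B $ 1 $ 1 \<in> Z_inv p \<and> B $ 1 $ 2 \<in> Z_inv p \<and> B $ 2 $ 1 \<in> Z_inv p \<and> B $ 2 $ 2 \<in> Z_inv p"
  by (simp add: Mat2_Z_inv_def forall_2)

lemma A_closed:
  "0 \<in> A" "u \<in> A \<Longrightarrow> v \<in> A \<Longrightarrow> u + v \<in> A" "u \<in> A \<Longrightarrow> v \<in> A \<Longrightarrow> u - v \<in> A" "v \<in> A \<Longrightarrow> - v \<in> A"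
  "c \<in> Z_inv p \<Longrightarrow> v \<in> A \<Longrightarrow> c *s v \<in> A"
  "c \<in> Z_inv p \<Longrightarrow> axis i c \<in> A"
  by (auto simp: A_iff Z_inv_closed axis_def)

lemma Mat2_mult_vec: "B \<in> Mat2_Z_inv p \<Longrightarrow> v \<in> A \<Longrightarrow> B *v v \<in> A"
  by (simp add: A_iff Mat2_iff matrix_vector_mult_def sum_2 Z_inv_closed)

lemma Mat2_closed:
  "mat 1 \<in> Mat2_Z_inv p"
  "B \<in> Mat2_Z_inv p \<Longrightarrow> C \<in> Mat2_Z_inv p \<Longrightarrow> B - C \<in> Mat2_Z_inv p"
  "B \<in> Mat2_Z_inv p \<Longrightarrow> C \<in> Mat2_Z_inv p \<Longrightarrow> B ** C \<in> Mat2_Z_inv p"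
  by (simp_all add: Mat2_iff mat_def matrix_matrix_mult_def sum_2 Z_inv_closed)

lemma det_Mat2: "B \<in> Mat2_Z_inv p \<Longrightarrow> det B \<in> Z_inv p"
  by (simp add: det_2 Mat2_iff Z_inv_closed)

lemma mult_Z_inv_sq [simp]: "u \<otimes>\<^bsub>Z_inv_sq p\<^esub> v = u + v"
  and one_Z_inv_sq [simp]: "\<one>\<^bsub>Z_inv_sq p\<^esub> = 0"
  by (simp_all add: Z_inv_sq_def)

lemma group_Z_inv_sq: "group (Z_inv_sq p)"
proof (rule groupI)
  show "\<exists>y\<in>A. y \<otimes>\<^bsub>Z_inv_sq p\<^esub> x = \<one>\<^bsub>Z_inv_sq p\<^esub>" if "x \<in> A" for x
    using that by (intro bexI[of _ "- x"]) (auto simp: A_closed)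
qed (auto simp: A_closed algebra_simps)

text \<open>Powers of \<open>p\<close> are units, so only the part \<open>m'\<close> of the
  numerator of \<open>d\<close> that is prime to \<open>p\<close> matters, and the integers modulo
  \<open>m'\<close> represent all classes.\<close>

lemma finite_residues:
  assumes p: "Factorial_Ring.prime p" and d: "d \<in> Z_inv p" "d \<noteq> 0"
  obtains S where "finite S" "S \<subseteq> Z_inv p"
    "\<And>x. x \<in> Z_inv p \<Longrightarrow> \<exists>s\<in>S. \<exists>c\<in>Z_inv p. x - s = d * c"
proof -
  obtain m k where dm: "d = of_int m / of_nat p ^ k"
    using Z_invE[OF d(1)] .
  with d(2) have "m \<noteq> 0" by auto
  moreover have "\<not> is_unit (int p)" using prime_gt_1_nat[OF p] by simp
  ultimately obtain j m' where m: "m = int p ^ j * m'" "\<not> int p dvd m'"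
    by (metis multiplicity_decompose')
  have m'0: "m' \<noteq> 0" using m by auto
  show ?thesis
  proof
    show "finite (of_int ` {0..<\<bar>m'\<bar>} :: rat set)" by simp
    show "of_int ` {0..<\<bar>m'\<bar>} \<subseteq> Z_inv p" by (auto simp: Z_inv_of_int)
    fix x assume "x \<in> Z_inv p"
    then obtain a n where x: "x = of_int a / of_nat p ^ n" by (rule Z_invE)
    \<comment> \<open>The denominator of \<open>x\<close> is invertible modulo \<open>m'\<close>;
      its inverse \<open>u\<close> yields an integer congruent to \<open>x\<close>.\<close>
    have "coprime (int p ^ n) m'"
      using p m(2) by (simp add: prime_imp_coprime)
    then obtain u where u: "[int p ^ n * u = 1] (mod m')"
      using cong_solve_coprime_int by blast
    \<comment> \<open>\<open>m'\<close> may be negative, so the reduction is modulo its absolute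
      value.\<close>
    define s where "s = (u * a) mod \<bar>m'\<bar>"
    have "[s = u * a] (mod \<bar>m'\<bar>)" by (simp add: s_def cong_def)
    then have "[s = u * a] (mod m')" by (simp add: cong_iff_dvd_diff)
    then have "[int p ^ n * s = int p ^ n * (u * a)] (mod m')" by (rule cong_scalar_left)
    also have "[int p ^ n * (u * a) = 1 * a] (mod m')"
      using cong_mult[OF u cong_refl[of a]] by (simp add: mult.assoc)
    finally obtain c where c: "a - int p ^ n * s = m' * c"
      by (auto simp: cong_iff_dvd_diff dvd_def) (metis minus_diff_eq mult_minus_right)
    have "s \<in> {0..<\<bar>m'\<bar>}" using m'0 by (simp add: s_def)
    moreover have "x - of_int s = of_int (a - int p ^ n * s) / of_nat p ^ n"
      using p_pos by (simp add: x diff_divide_distrib)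
    \<comment> \<open>\<open>m'\<close> equals \<open>d\<close> times \<open>p ^ k / p ^ j\<close>,
      so the cofactor picks up these powers of \<open>p\<close> and stays in Z[1/p].\<close>
    then have "x - of_int s = d * (of_int (c * int p ^ k) / of_nat p ^ (j + n))"
      unfolding c using p_pos by (simp add: dm m(1) power_add)
    ultimately show "\<exists>s\<in>of_int ` {0..<\<bar>m'\<bar>}. \<exists>c\<in>Z_inv p. x - s = d * c"
      using Z_inv_fraction by blast
  qed
qed

text \<open>\<open>B\<close> times its adjugate is \<open>det B\<close>, so the image of
  \<open>B\<close> contains \<open>det B\<close> times \<open>A\<close>, and residues modulo
  \<open>det B\<close> in each coordinate meet every coset.\<close>

lemma finite_cokernel:
  assumes p: "Factorial_Ring.prime p" and B: "B \<in> Mat2_Z_inv p" "det B \<noteq> 0"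
  obtains S where "finite S" "S \<subseteq> A" "\<And>v. v \<in> A \<Longrightarrow> \<exists>s\<in>S. \<exists>a\<in>A. v - s = B *v a"
proof -
  obtain S where S: "finite S" "S \<subseteq> Z_inv p"
    "\<And>x. x \<in> Z_inv p \<Longrightarrow> \<exists>s\<in>S. \<exists>c\<in>Z_inv p. x - s = det B * c"
    using finite_residues[OF p det_Mat2[OF B(1)] B(2)] by blast
  show ?thesis
  proof
    show "finite ((\<lambda>(s, t). vector [s, t] :: rat ^ 2) ` (S \<times> S))" using S(1) by simp
    show "(\<lambda>(s, t). vector [s, t]) ` (S \<times> S) \<subseteq> A" using S(2) by (auto simp: A_iff)
    fix v assume "v \<in> A"
    then obtain s t c d where *: "s \<in> S" "t \<in> S" "c \<in> Z_inv p" "d \<in> Z_inv p"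
      "v $ 1 - s = det B * c" "v $ 2 - t = det B * d"
      using S(3)[of "v $ 1"] S(3)[of "v $ 2"] by (auto simp: A_iff)
    \<comment> \<open>the adjugate of \<open>B\<close> applied to \<open>(c, d)\<close>\<close>
    let ?a = "vector [B$2$2 * c - B$1$2 * d, B$1$1 * d - B$2$1 * c] :: rat ^ 2"
    have "?a \<in> A" using B(1) *(3,4) by (simp add: A_iff Mat2_iff Z_inv_closed)
    moreover have "v - vector [s, t] = B *v ?a"
      using *(5,6) by (simp add: vec_eq_iff forall_2 matrix_vector_mult_def sum_2 det_2 algebra_simps)
    ultimately show "\<exists>s\<in>(\<lambda>(s, t). vector [s, t]) ` (S \<times> S). \<exists>a\<in>A. v - s = B *v a"
      using *(1,2) by auto
  qed
qed

text \<open>Additivity gives linearity over the integers, and over Z[1/p] because the values lie in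
  a torsion-free group. The values at the unit vectors are the columns of the matrix.\<close>

lemma additive_imp_matrix:
  assumes f: "f \<in> A \<rightarrow> A" and add: "\<And>u v. u \<in> A \<Longrightarrow> v \<in> A \<Longrightarrow> f (u + v) = f u + f v"
  obtains N where "N \<in> Mat2_Z_inv p" "\<And>v. v \<in> A \<Longrightarrow> f v = N *v v"
proof -
  have f0: "f 0 = 0" using add[of 0 0] by (simp add: A_closed)
  have nat: "f (of_nat k *s v) = of_nat k *s f v" if "v \<in> A" for k v
  proof (induction k)
    case (Suc k)
    have "of_nat k *s v \<in> A" using that A_closed(5) Z_inv_of_int[of "int k"] by simp
    with Suc add[of v "of_nat k *s v"] that show ?case
      by (simp add: vector_sadd_rdistrib)
  qed (simp add: f0)
  have minus: "f (- v) = - f v" if "v \<in> A" for v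
    using add[of v "- v"] that by (simp add: A_closed f0 eq_neg_iff_add_eq_0 add.commute)
  have int: "f (of_int k *s v) = of_int k *s f v" if "v \<in> A" for k v
  proof (cases k rule: int_cases2)
    case (nonneg n)
    with nat[OF that, of n] show ?thesis by simp
  next
    case (nonpos n)
    have "of_nat n *s v \<in> A" using that A_closed(5) Z_inv_of_int[of "int n"] by simp
    with nonpos nat[OF that, of n] minus[of "of_nat n *s v"] show ?thesis
      by (simp add: vec_eq_iff)
  qed
  have lin: "f (c *s v) = c *s f v" if "c \<in> Z_inv p" "v \<in> A" for c v
  proof -
    from that(1) obtain a n where c: "c = of_int a / of_nat p ^ n" by (rule Z_invE)
    \<comment> \<open>Multiplying by \<open>p ^ n\<close> reduces the claim to integer scalars; the
      factor is cancelled afterwards.\<close>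
    have "of_int (int p ^ n) *s f (c *s v) = f (of_int (int p ^ n) *s (c *s v))"
      using that by (intro int[symmetric] A_closed)
    also have "of_int (int p ^ n) *s (c *s v) = of_int a *s v"
      using p_pos by (simp add: c vector_smult_assoc)
    finally have "of_int (int p ^ n) *s f (c *s v) = of_int a *s f v"
      using int[OF that(2)] by simp
    then show ?thesis using p_pos by (simp add: vec_eq_iff c field_simps)
  qed
  let ?N = "\<chi> i j. f (axis j 1) $ i"
  have e: "f (axis j 1) \<in> A" for j
    using f by (simp add: A_closed Z_inv_1 Pi_iff)
  show ?thesis
  proof
    show "?N \<in> Mat2_Z_inv p" using e by (simp add: Mat2_iff A_iff)
    fix v assume v: "v \<in> A"
    have "v $ 1 *s axis 1 1 + v $ 2 *s axis 2 1 = v"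
      by (simp add: vec_eq_iff forall_2 axis_def)
    moreover have "f (v $ 1 *s axis 1 1 + v $ 2 *s axis 2 1) = v $ 1 *s f (axis 1 1) + v $ 2 *s f (axis 2 1)"
      using v by (simp add: add lin A_closed A_iff Z_inv_closed axis_def)
    ultimately have "f v = v $ 1 *s f (axis 1 1) + v $ 2 *s f (axis 2 1)"
      by (simp only:)
    then show "f v = ?N *v v"
      by (simp add: vec_eq_iff forall_2 matrix_vector_mult_def sum_2 algebra_simps)
  qed
qed

text \<open>The unit vectors lie in \<open>A\<close> and pick out the columns.\<close>

lemma matrix_eq_on_A:
  fixes B C :: "rat ^ 2 ^ 2"
  assumes "\<And>v. v \<in> A \<Longrightarrow> B *v v = C *v v"
  shows "B = C"
proof -
  have entry: "D $ i $ j = (D *v axis j 1) $ i" for D :: "rat ^ 2 ^ 2" and i j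
    by (simp add: matrix_vector_mult_def axis_def if_distrib cong: if_cong)
  have "B *v axis j 1 = C *v axis j 1" for j
    using assms by (simp add: A_closed Z_inv_1)
  then have "B $ i $ j = C $ i $ j" for i j
    using entry[of B i j] entry[of C i j] by simp
  then show ?thesis by (simp add: vec_eq_iff)
qed

text \<open>\<open>A\<close> is \<open>p\<close>-divisible, so every value of \<open>f\<close> is
  divisible by all powers of \<open>p\<close>. This is what forces endomorphisms of the semidirect
  product to map \<open>A\<close> into itself.\<close>

lemma additive_to_int_eq_0:
  fixes f :: "rat ^ 2 \<Rightarrow> int"
  assumes p: "p > 1" and add: "\<And>u v. u \<in> A \<Longrightarrow> v \<in> A \<Longrightarrow> f (u + v) = f u + f v" and v: "v \<in> A"
  shows "f v = 0"
proof (rule ccontr)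
  assume nz: "f v \<noteq> 0"
  have f0: "f 0 = 0" using add[of 0 0] by (simp add: A_closed)
  have nat: "f (of_nat k *s v) = of_nat k * f v" if "v \<in> A" for k v
  proof (induction k)
    case (Suc k)
    have "of_nat k *s v \<in> A" using that A_closed(5) Z_inv_of_int[of "int k"] by simp
    with Suc add[of v "of_nat k *s v"] that show ?case
      by (simp add: vector_sadd_rdistrib algebra_simps)
  qed (simp add: f0)
  have "int p ^ n dvd f v" for n
  proof -
    have "(1 / of_nat p ^ n) *s v \<in> A" using v A_closed(5) Z_inv_fraction[of 1 n] by simp
    from nat[OF this, of "p ^ n"] show ?thesis
      using p by (simp add: vector_smult_assoc)
  qed
  \<comment> \<open>The absolute value of \<open>f v\<close>, taken as the exponent, already gives a
    power of \<open>p\<close> too large to divide \<open>f v\<close>.\<close>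
  then have "int p ^ nat \<bar>f v\<bar> \<le> \<bar>f v\<bar>"
    using nz by (meson dvd_abs_iff zdvd_imp_le zero_less_abs_iff)
  moreover have "nat \<bar>f v\<bar> < p ^ nat \<bar>f v\<bar>" using p by (intro power_gt_expt) simp
  then have "\<bar>f v\<bar> < int p ^ nat \<bar>f v\<bar>" by (metis nat_less_iff abs_ge_zero of_nat_power)
  ultimately show False by simp
qed

end

text \<open>A kernel vector of the transpose is a functional vanishing on the image of
  \<open>B\<close>; it serves to tell cosets of that image apart.\<close>

lemma det_0_left_kernel:
  fixes B :: "'a::field ^ 'n ^ 'n"
  assumes "det B = 0"
  obtains w where "w \<noteq> 0" "\<And>v. (\<Sum>i\<in>UNIV. w $ i * (B *v v) $ i) = 0"
proof -
  have "\<not> invertible (transpose B)"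
    using assms by (simp add: invertible_det_nz det_transpose)
  then obtain w where w: "w \<noteq> 0" "transpose B *v w = 0"
    by (metis invertible_left_inverse matrix_left_invertible_ker)
  have "(\<Sum>i\<in>UNIV. w $ i * (B *v v) $ i) = 0" for v
  proof -
    have "(\<Sum>i\<in>UNIV. w $ i * (B *v v) $ i) = (\<Sum>i\<in>UNIV. \<Sum>j\<in>UNIV. w $ i * (B $ i $ j * v $ j))"
      by (simp add: matrix_vector_mult_def sum_distrib_left)
    also have "\<dots> = (\<Sum>j\<in>UNIV. \<Sum>i\<in>UNIV. w $ i * (B $ i $ j * v $ j))"
      by (rule sum.swap)
    also have "\<dots> = (\<Sum>j\<in>UNIV. (transpose B *v w) $ j * v $ j)"
      by (simp add: matrix_vector_mult_def transpose_def sum_distrib_left mult.commute mult.left_commute)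
    finally show ?thesis by (simp only: w(2)) simp
  qed
  with w show ?thesis by (intro that[of w]) auto
qed

section \<open>Twisted conjugacy in an arbitrary group\<close>

text \<open>Multiplying by \<open>\<phi> g\<close> on the right removes the inverse, so that later
  no inverse in a semidirect product has to be computed.\<close>

lemma reidemeister_rel_iff:
  fixes G (structure)
  assumes "group G" "\<phi> \<in> hom G G"
  shows "(x, y) \<in> reidemeister_rel G \<phi> \<longleftrightarrow>
    x \<in> carrier G \<and> y \<in> carrier G \<and> (\<exists>g\<in>carrier G. y \<otimes>\<^bsub>G\<^esub> \<phi> g = g \<otimes>\<^bsub>G\<^esub> x)"
proof -
  interpret group G by fact
  interpret group_hom G G \<phi> by unfold_locales fact
  have "y = g \<otimes> x \<otimes> \<phi> (inv g) \<longleftrightarrow> y \<otimes> \<phi> g = g \<otimes> x"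
    if "x \<in> carrier G" "y \<in> carrier G" "g \<in> carrier G" for g
    using that by (metis hom_inv inv_solve_right hom_closed m_closed)
  then show ?thesis unfolding reidemeister_rel_def by blast
qed

lemma equiv_reidemeister_rel:
  fixes G (structure)
  assumes "group G" "\<phi> \<in> hom G G"
  shows "equiv (carrier G) (reidemeister_rel G \<phi>)"
proof -
  interpret group G by fact
  interpret group_hom G G \<phi> by unfold_locales fact
  note iff = reidemeister_rel_iff[OF assms]
  show ?thesis
  proof (rule equivI)
    show "reidemeister_rel G \<phi> \<subseteq> carrier G \<times> carrier G"
      by (auto simp: reidemeister_rel_def)
    show "refl_on (carrier G) (reidemeister_rel G \<phi>)"
      by (auto simp: refl_on_def iff intro!: bexI[of _ \<one>])
    show "sym (reidemeister_rel G \<phi>)"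
    proof (rule symI, unfold iff, safe)
      fix x y g assume xy: "x \<in> carrier G" "y \<in> carrier G" and g: "g \<in> carrier G" "y \<otimes> \<phi> g = g \<otimes> x"
      have "x = inv g \<otimes> (y \<otimes> \<phi> g)" using xy g by (simp add: inv_solve_left)
      then have "x \<otimes> \<phi> (inv g) = inv g \<otimes> y" using xy g(1) by (simp add: m_assoc)
      with g(1) show "\<exists>g\<in>carrier G. x \<otimes> \<phi> g = g \<otimes> y" by blast
    qed
    show "trans (reidemeister_rel G \<phi>)"
    proof (rule transI, unfold iff, safe)
      fix x y z g h
      assume *: "x \<in> carrier G" "y \<in> carrier G" "z \<in> carrier G" "g \<in> carrier G" "h \<in> carrier G"
        and g: "y \<otimes> \<phi> g = g \<otimes> x" and h: "z \<otimes> \<phi> h = h \<otimes> y"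
      have "z \<otimes> \<phi> (h \<otimes> g) = h \<otimes> (y \<otimes> \<phi> g)" using * h by (simp flip: m_assoc)
      then have "z \<otimes> \<phi> (h \<otimes> g) = (h \<otimes> g) \<otimes> x" using * g by (simp add: m_assoc)
      with * show "\<exists>g\<in>carrier G. z \<otimes> \<phi> g = g \<otimes> x" by blast
    qed
  qed
qed

lemma reidemeister_number_eq_infinity:
  fixes f :: "nat \<Rightarrow> 'a"
  assumes "group G" "\<phi> \<in> hom G G" "range f \<subseteq> carrier G"
    and "\<And>i j. (f i, f j) \<in> reidemeister_rel G \<phi> \<Longrightarrow> i = j"
  shows "reidemeister_number G \<phi> = \<infinity>"
proof -
  let ?c = "\<lambda>i. reidemeister_rel G \<phi> `` {f i}"
  have "inj ?c"
    using assms by (auto intro!: injI dest: eq_equiv_class[OF _ equiv_reidemeister_rel])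
  moreover have "range ?c \<subseteq> reidemeister_classes G \<phi>"
    using assms(3) by (auto simp: reidemeister_classes_def intro: quotientI)
  ultimately have "infinite (reidemeister_classes G \<phi>)"
    using finite_subset range_inj_infinite by blast
  then show ?thesis by (simp add: reidemeister_number_def)
qed

lemma reidemeister_number_neq_infinity:
  assumes "group G" "\<phi> \<in> hom G G" "finite S"
    and "\<And>y. y \<in> carrier G \<Longrightarrow> \<exists>s\<in>S. (s, y) \<in> reidemeister_rel G \<phi>"
  shows "reidemeister_number G \<phi> \<noteq> \<infinity>"
proof -
  have "reidemeister_classes G \<phi> \<subseteq> (\<lambda>s. reidemeister_rel G \<phi> `` {s}) ` S"
  proof
    fix C assume "C \<in> reidemeister_classes G \<phi>"
    then obtain y where y: "y \<in> carrier G" "C = reidemeister_rel G \<phi> `` {y}"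
      by (auto simp: reidemeister_classes_def elim: quotientE)
    obtain s where "s \<in> S" "(s, y) \<in> reidemeister_rel G \<phi>" using assms(4) y(1) by blast
    with y show "C \<in> (\<lambda>s. reidemeister_rel G \<phi> `` {s}) ` S"
      using equiv_class_eq[OF equiv_reidemeister_rel[OF assms(1,2)]] by blast
  qed
  with assms(3) have "finite (reidemeister_classes G \<phi>)" using finite_surj by blast
  then show ?thesis by (simp add: reidemeister_number_def)
qed

section \<open>Actions by automorphisms and semidirect products\<close>

text \<open>The product of \<open>AutoGroup\<close> is composition restricted to the carrier and its
  unit is the restricted identity; hence the action laws are stated for arguments in
  \<open>carrier A\<close>.\<close>

lemma hom_AutoGroupD:
  assumes "group A" "group H" "\<theta> \<in> hom H (AutoGroup A)"
  shows hom_AutoGroup_hom: "h \<in> carrier H \<Longrightarrow> \<theta> h \<in> hom A A"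
    and hom_AutoGroup_mult: "\<lbrakk>h \<in> carrier H; k \<in> carrier H; a \<in> carrier A\<rbrakk> \<Longrightarrow> \<theta> (h \<otimes>\<^bsub>H\<^esub> k) a = \<theta> h (\<theta> k a)"
    and hom_AutoGroup_one: "a \<in> carrier A \<Longrightarrow> \<theta> \<one>\<^bsub>H\<^esub> a = a"
proof -
  have auto: "\<theta> h \<in> auto A" if "h \<in> carrier H" for h
    using hom_in_carrier[OF assms(3) that] by (simp add: AutoGroup_def)
  then show "h \<in> carrier H \<Longrightarrow> \<theta> h \<in> hom A A" by (simp add: auto_def)
  show "\<theta> (h \<otimes>\<^bsub>H\<^esub> k) a = \<theta> h (\<theta> k a)" if "h \<in> carrier H" "k \<in> carrier H" "a \<in> carrier A"
    using hom_mult[OF assms(3) that(1,2)] auto[OF that(1)] auto[OF that(2)] that(3)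
    by (simp add: AutoGroup_def BijGroup_def auto_def compose_eq)
  show "\<theta> \<one>\<^bsub>H\<^esub> a = a" if "a \<in> carrier A"
    using hom_one[OF assms(3,2) group.AutoGroup[OF assms(1)]] that
    by (simp add: AutoGroup_def BijGroup_def)
qed

lemma group_semidirect_product:
  assumes "group A" "group H" "\<theta> \<in> hom H (AutoGroup A)"
  shows "group (semidirect_product A H \<theta>)"
proof -
  interpret A: group A by fact
  interpret H: group H by fact
  note \<theta> = hom_AutoGroupD[OF assms]
  have cl: "\<theta> h a \<in> carrier A" if "h \<in> carrier H" "a \<in> carrier A" for h a
    using hom_in_carrier[OF \<theta>(1)[OF that(1)] that(2)] .
  show ?thesis
  proof (rule groupI)
    fix x assume "x \<in> carrier (semidirect_product A H \<theta>)"
    then obtain a h where x: "x = (a, h)" "a \<in> carrier A" "h \<in> carrier H"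
      by (auto simp: semidirect_product_def)
    \<comment> \<open>\<open>groupI\<close> asks for a left inverse of \<open>(a, h)\<close>: its
      second component is the inverse of \<open>h\<close>, so its first must cancel \<open>a\<close>
      acted on by that inverse.\<close>
    then have "inv\<^bsub>A\<^esub> \<theta> (inv\<^bsub>H\<^esub> h) a \<otimes>\<^bsub>A\<^esub> \<theta> (inv\<^bsub>H\<^esub> h) a = \<one>\<^bsub>A\<^esub>"
      using cl by simp
    with x cl show "\<exists>y\<in>carrier (semidirect_product A H \<theta>).
        y \<otimes>\<^bsub>semidirect_product A H \<theta>\<^esub> x = \<one>\<^bsub>semidirect_product A H \<theta>\<^esub>"
      by (intro bexI[of _ "(inv\<^bsub>A\<^esub> \<theta> (inv\<^bsub>H\<^esub> h) a, inv\<^bsub>H\<^esub> h)"]) (auto simp: semidirect_product_def)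
  qed (auto simp: semidirect_product_def cl \<theta>(2,3) hom_mult[OF \<theta>(1)] A.m_assoc H.m_assoc)
qed

text \<open>A nonzero functional vanishing on the image of \<open>B\<close> has a nonzero
  coefficient at some \<open>k\<close>, so it separates the natural multiples of the unit vector
  \<open>axis k 1\<close>.\<close>

lemma (in Z_inv_ring) infinite_cokernel:
  assumes "det B = 0"
  obtains f :: "nat \<Rightarrow> rat ^ 2"
  where "range f \<subseteq> A" "\<And>i j a. f j - f i = B *v a \<Longrightarrow> i = j"
proof -
  obtain w where w: "w \<noteq> 0" "\<And>v. (\<Sum>i\<in>UNIV. w $ i * (B *v v) $ i) = 0"
    using det_0_left_kernel[OF assms] by blast
  then obtain k where k: "w $ k \<noteq> 0" by (auto simp: vec_eq_iff)
  show ?thesis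
  proof
    show "range (\<lambda>n. axis k (of_nat n)) \<subseteq> A"
      using Z_inv_of_int[of "int n" for n] by (auto intro!: A_closed)
    fix i j a assume "axis k (of_nat j) - axis k (of_nat i) = B *v a"
    then have "(\<Sum>l\<in>UNIV. w $ l * (axis k (of_nat j) - axis k (of_nat i)) $ l) = 0"
      using w(2)[of a] by simp
    then have "w $ k * (of_nat j - of_nat i) = 0"
      by (simp add: axis_def if_distrib if_distribR sum.delta algebra_simps sum_subtractf cong: if_cong)
    with k show "i = j" by simp
  qed
qed

section \<open>The semidirect product \<open>G\<close> and the action of Z on
  \<open>A\<close>\<close>

locale Z_inv_sq_by_Z =
  fixes p :: nat and \<theta> :: "int \<Rightarrow> rat ^ 2 \<Rightarrow> rat ^ 2" and M :: "rat ^ 2 ^ 2"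
  assumes prime_p: "Factorial_Ring.prime p"
    and \<theta>_hom: "\<theta> \<in> hom integer_group (AutoGroup (Z_inv_sq p))"
    and M_GL2: "M \<in> GL2_Z_inv p"
    and \<theta>_1: "\<And>v. v \<in> carrier (Z_inv_sq p) \<Longrightarrow> \<theta> 1 v = M *v v"
begin

sublocale Z_inv_ring p
  by unfold_locales (rule prime_gt_0_nat[OF prime_p])

abbreviation "G \<equiv> semidirect_product (Z_inv_sq p) integer_group \<theta>"

lemma mem_G [simp]: "(a, h) \<in> carrier G \<longleftrightarrow> a \<in> A"
  by (simp add: semidirect_product_def)

lemma mult_G [simp]: "(a, h) \<otimes>\<^bsub>G\<^esub> (b, k) = (a + \<theta> h b, h + k)"
  by (simp add: semidirect_product_def)

lemma group_G: "group G"
  using group_Z_inv_sq group_integer_group \<theta>_hom by (rule group_semidirect_product)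

lemmas \<theta>_hom_Z_inv_sq = hom_AutoGroup_hom[OF group_Z_inv_sq group_integer_group \<theta>_hom, simplified]

lemma \<theta>_closed: "a \<in> A \<Longrightarrow> \<theta> h a \<in> A"
  by (rule hom_in_carrier[OF \<theta>_hom_Z_inv_sq])

lemma \<theta>_add: "a \<in> A \<Longrightarrow> b \<in> A \<Longrightarrow> \<theta> h (a + b) = \<theta> h a + \<theta> h b"
  using hom_mult[OF \<theta>_hom_Z_inv_sq] by simp

lemma \<theta>_plus: "a \<in> A \<Longrightarrow> \<theta> (h + k) a = \<theta> h (\<theta> k a)"
  using hom_AutoGroup_mult[OF group_Z_inv_sq group_integer_group \<theta>_hom] by simp

lemma \<theta>_0: "a \<in> A \<Longrightarrow> \<theta> 0 a = a"
  using hom_AutoGroup_one[OF group_Z_inv_sq group_integer_group \<theta>_hom] by simp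

lemma \<theta>_at_0: "\<theta> h 0 = 0"
  using \<theta>_add[of 0 0 h] by (simp add: A_closed)

lemma \<theta>_cancel: "a \<in> A \<Longrightarrow> \<theta> (- h) (\<theta> h a) = a" "a \<in> A \<Longrightarrow> \<theta> h (\<theta> (- h) a) = a"
  using \<theta>_plus[of a "- h" h] \<theta>_plus[of a h "- h"] by (simp_all add: \<theta>_0)

lemma M_Mat2: "M \<in> Mat2_Z_inv p"
  using M_GL2 by (simp add: GL2_Z_inv_def)

lemma \<theta>_1_N_\<theta>_1:
  "N \<in> Mat2_Z_inv p \<Longrightarrow> a \<in> A \<Longrightarrow> \<theta> 1 (N *v \<theta> 1 a) = (M ** N ** M) *v a"
  by (simp add: \<theta>_1 Mat2_mult_vec M_Mat2 flip: matrix_vector_mul_assoc)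

text \<open>\<open>N = MNM\<close> says that \<open>N\<close> intertwines \<open>\<theta> 1\<close>
  with \<open>\<theta> (- 1)\<close>; induction in both directions extends this to all
  \<open>h\<close>. It makes \<open>flip_auto N\<close> a homomorphism.\<close>

lemma MNM_commute:
  assumes N: "N \<in> Mat2_Z_inv p" "N = M ** N ** M" and a: "a \<in> A"
  shows "N *v \<theta> h a = \<theta> (- h) (N *v a)"
proof -
  have step: "N *v \<theta> 1 a = \<theta> (- 1) (N *v a)" if "a \<in> A" for a
  proof -
    have "\<theta> 1 (N *v \<theta> 1 a) = (M ** N ** M) *v a"
      using N(1) that by (rule \<theta>_1_N_\<theta>_1)
    then have "\<theta> (- 1) (\<theta> 1 (N *v \<theta> 1 a)) = \<theta> (- 1) (N *v a)"
      using N(2) by simp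
    then show ?thesis using that N(1) by (simp add: \<theta>_cancel \<theta>_closed Mat2_mult_vec)
  qed
  \<comment> \<open>This is \<open>step\<close> at \<open>\<theta> (- 1) a\<close>, with
    \<open>\<theta> 1\<close> applied to both sides.\<close>
  have step': "N *v \<theta> (- 1) a = \<theta> 1 (N *v a)" if "a \<in> A" for a
  proof -
    have "N *v a = \<theta> (- 1) (N *v \<theta> (- 1) a)"
      using step[of "\<theta> (- 1) a"] that by (simp add: \<theta>_closed \<theta>_cancel)
    then show ?thesis using that N(1) by (simp add: \<theta>_closed \<theta>_cancel Mat2_mult_vec)
  qed
  show ?thesis
    using a
  proof (induction h arbitrary: a rule: int_induct[where k = 0])
    case base
    then show ?case using N(1) by (simp add: \<theta>_0 Mat2_mult_vec)
  next
    case (step1 i)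
    have "\<theta> (- (i + 1)) (N *v a) = \<theta> (- i) (\<theta> (- 1) (N *v a))"
      using \<theta>_plus[of "N *v a" "- i" "- 1"] step1.prems N(1) by (simp add: Mat2_mult_vec)
    then show ?case using step1 by (simp add: \<theta>_plus step \<theta>_closed)
  next
    case (step2 i)
    have "\<theta> (- (i - 1)) (N *v a) = \<theta> (- i) (\<theta> 1 (N *v a))"
      using \<theta>_plus[of "N *v a" "- i" 1] step2.prems N(1) by (simp add: Mat2_mult_vec)
    moreover have "\<theta> (i - 1) a = \<theta> i (\<theta> (- 1) a)"
      using \<theta>_plus[of a i "- 1"] step2.prems by simp
    ultimately show ?case using step2 by (simp add: step' \<theta>_closed)
  qed
qed

section \<open>Automorphisms inverting Z and their finite Reidemeister numbers\<close>

text \<open>The lambda is restricted to the carrier because elements of \<open>auto G\<close> are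
  extensional.\<close>

definition flip_auto :: "rat ^ 2 ^ 2 \<Rightarrow> (rat ^ 2) \<times> int \<Rightarrow> (rat ^ 2) \<times> int" where
  "flip_auto N = (\<lambda>(a, h)\<in>carrier G. (N *v a, - h))"

lemma flip_auto_apply [simp]: "a \<in> A \<Longrightarrow> flip_auto N (a, h) = (N *v a, - h)"
  by (simp add: flip_auto_def)

text \<open>Multiplicativity comes from \<open>MNM_commute\<close>; the inverse map applies the
  inverse matrix and negates the integer again.\<close>

lemma flip_auto:
  assumes N: "N \<in> GL2_Z_inv p" "N = M ** N ** M"
  shows "flip_auto N \<in> auto G"
proof -
  obtain B where B: "B \<in> Mat2_Z_inv p" "N ** B = mat 1" "B ** N = mat 1" and N': "N \<in> Mat2_Z_inv p"
    using N(1) by (auto simp: GL2_Z_inv_def)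
  have "flip_auto N \<in> hom G G"
    unfolding hom_def using N' MNM_commute[OF N' N(2)]
    by (auto simp: Mat2_mult_vec A_closed \<theta>_closed matrix_vector_right_distrib)
  moreover have "bij_betw (flip_auto N) (carrier G) (carrier G)"
    by (rule bij_betw_byWitness[where f' = "\<lambda>(a, h). (B *v a, - h)"])
      (use N' B in \<open>auto simp: Mat2_mult_vec matrix_vector_mul_assoc\<close>)
  moreover have "flip_auto N \<in> extensional (carrier G)"
    by (simp add: flip_auto_def)
  ultimately show ?thesis by (simp add: auto_def Bij_def)
qed

text \<open>Twisted conjugation by an element over \<open>m\<close> shifts the integer by
  \<open>2 * m\<close>, so only its parity \<open>r\<close> survives; over \<open>r\<close> it
  remains to reduce modulo the image of \<open>1 - N\<close> or \<open>1 - MN\<close>, whose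
  cokernels are finite.\<close>

lemma reidemeister_number_flip_auto:
  assumes N: "N \<in> GL2_Z_inv p" "N = M ** N ** M"
    and det: "det (mat 1 - N) \<noteq> 0" "det (mat 1 - M ** N) \<noteq> 0"
  shows "reidemeister_number G (flip_auto N) \<noteq> \<infinity>"
proof -
  have N': "N \<in> Mat2_Z_inv p" using N(1) by (simp add: GL2_Z_inv_def)
  have hom: "flip_auto N \<in> hom G G" using flip_auto[OF N] by (simp add: auto_def)
  obtain S where S: "finite S" "S \<subseteq> A" "\<And>v. v \<in> A \<Longrightarrow> \<exists>s\<in>S. \<exists>a\<in>A. v - s = (mat 1 - N) *v a"
    using finite_cokernel[OF prime_p _ det(1)] N' by (auto simp: Mat2_closed)
  obtain T where T: "finite T" "T \<subseteq> A" "\<And>v. v \<in> A \<Longrightarrow> \<exists>s\<in>T. \<exists>a\<in>A. v - s = (mat 1 - M ** N) *v a"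
    using finite_cokernel[OF prime_p _ det(2)] N' M_Mat2 by (auto simp: Mat2_closed)
  show ?thesis
  proof (rule reidemeister_number_neq_infinity[OF group_G hom])
    show "finite (S \<times> {0} \<union> T \<times> {1 :: int})" using S(1) T(1) by simp
    fix y assume "y \<in> carrier G"
    then obtain v k where y: "y = (v, k)" "v \<in> A" by (cases y) auto
    define m r where "m = k div 2" and "r = k mod 2"
    have k: "k = 2 * m + r" "r = 0 \<or> r = 1" by (auto simp: m_def r_def)
    have "\<theta> (- m) v \<in> A" using y by (simp add: \<theta>_closed)
    \<comment> \<open>Both parities fit one equation, since \<open>\<theta> 0\<close> is the
      identity and \<open>\<theta> 1\<close> is \<open>M\<close>.\<close>
    then obtain s a where sa: "(s, r) \<in> S \<times> {0} \<union> T \<times> {1 :: int}" "s \<in> A" "a \<in> A"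
      "\<theta> (- m) v - s = a - \<theta> r (N *v a)"
    proof (cases "r = 0")
      case True
      obtain s a where "s \<in> S" "a \<in> A" "\<theta> (- m) v - s = (mat 1 - N) *v a"
        using S(3)[OF \<open>\<theta> (- m) v \<in> A\<close>] by blast
      with True S(2) N' show ?thesis
        by (intro that[of s a]) (auto simp: matrix_vector_mult_diff_rdistrib \<theta>_0 Mat2_mult_vec)
    next
      case False
      with k(2) have "r = 1" by simp
      obtain s a where "s \<in> T" "a \<in> A" "\<theta> (- m) v - s = (mat 1 - M ** N) *v a"
        using T(3)[OF \<open>\<theta> (- m) v \<in> A\<close>] by blast
      with \<open>r = 1\<close> T(2) N' show ?thesis
        by (intro that[of s a])
          (auto simp: matrix_vector_mult_diff_rdistrib \<theta>_1 Mat2_mult_vec matrix_vector_mul_assoc)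
    qed
    \<comment> \<open>Conjugating by \<open>\<theta> m\<close> turns the reduction of \<open>\<theta> (- m) v\<close> modulo the image of
      \<open>1 - \<theta> r N\<close> into the twisted conjugacy of \<open>(v, k)\<close> and \<open>(s, r)\<close>, because \<open>N \<theta> m = \<theta> (- m) N\<close>.\<close>
    have Na: "N *v a \<in> A" using sa(3) N' by (simp add: Mat2_mult_vec)
    have "v + \<theta> k (N *v \<theta> m a) = v + \<theta> (m + r) (N *v a)"
    proof -
      have "\<theta> k (N *v \<theta> m a) = \<theta> (k + - m) (N *v a)"
        using Na MNM_commute[OF N' N(2) sa(3)] by (simp only: \<theta>_plus)
      then show ?thesis by (simp add: k(1))
    qed
    also have "\<dots> = \<theta> m (\<theta> (- m) v + \<theta> r (N *v a))"
      using y(2) Na by (simp add: \<theta>_add \<theta>_closed \<theta>_cancel \<theta>_plus)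
    also have "\<theta> (- m) v + \<theta> r (N *v a) = a + s" using sa(4) by (simp add: algebra_simps)
    also have "\<theta> m (a + s) = \<theta> m a + \<theta> m s" using sa by (simp add: \<theta>_add)
    finally have "(v, k) \<otimes>\<^bsub>G\<^esub> flip_auto N (\<theta> m a, m) = (\<theta> m a, m) \<otimes>\<^bsub>G\<^esub> (s, r)"
      using sa(3) k(1) by (simp add: \<theta>_closed)
    moreover have "(\<theta> m a, m) \<in> carrier G" using sa(3) by (simp add: \<theta>_closed)
    ultimately have "((s, r), y) \<in> reidemeister_rel G (flip_auto N)"
      using y(2) sa(2) unfolding y(1) reidemeister_rel_iff[OF group_G hom]
      by (intro conjI bexI[of _ "(\<theta> m a, m)"]) (simp_all del: mult_G)
    with sa(1) show "\<exists>s\<in>S \<times> {0} \<union> T \<times> {1 :: int}. (s, y) \<in> reidemeister_rel G (flip_auto N)"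
      by blast
  qed
qed

section \<open>The shape of endomorphisms and automorphisms of \<open>G\<close>\<close>

text \<open>Stated for endomorphisms so that it applies both to an automorphism and to its
  inverse.\<close>

lemma hom_G:
  assumes "\<phi> \<in> hom G G"
  obtains N e where "N \<in> Mat2_Z_inv p"
    "\<And>a. a \<in> A \<Longrightarrow> \<phi> (a, 0) = (N *v a, 0)" "\<And>a k. a \<in> A \<Longrightarrow> snd (\<phi> (a, k)) = e * k"
proof -
  have cl: "fst (\<phi> (a, k)) \<in> A" if "a \<in> A" for a k
    using hom_in_carrier[OF assms, of "(a, k)"] that by (cases "\<phi> (a, k)") simp
  have mult: "\<phi> (a + \<theta> h b, h + k) =
      (fst (\<phi> (a, h)) + \<theta> (snd (\<phi> (a, h))) (fst (\<phi> (b, k))), snd (\<phi> (a, h)) + snd (\<phi> (b, k)))"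
    if "a \<in> A" "b \<in> A" for a b h k
    using hom_mult[OF assms, of "(a, h)" "(b, k)"] that
    by (cases "\<phi> (a, h)"; cases "\<phi> (b, k)") simp
  have snd0: "snd (\<phi> (a, 0)) = 0" if "a \<in> A" for a
  proof (rule additive_to_int_eq_0[where f = "\<lambda>a. snd (\<phi> (a, 0))"])
    show "1 < p" using prime_p by (rule prime_gt_1_nat)
    show "snd (\<phi> (u + v, 0)) = snd (\<phi> (u, 0)) + snd (\<phi> (v, 0))" if "u \<in> A" "v \<in> A" for u v
      using mult[OF that, of 0 0] that by (simp add: \<theta>_0)
  qed (fact that)
  \<comment> \<open>Images of elements of \<open>A\<close> have second component 0, so the twist in
    \<open>mult\<close> is by \<open>\<theta> 0\<close> and disappears.\<close>
  have "fst (\<phi> (u + v, 0)) = fst (\<phi> (u, 0)) + fst (\<phi> (v, 0))" if "u \<in> A" "v \<in> A" for u v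
    using mult[OF that, of 0 0] that by (simp add: \<theta>_0 snd0 cl)
  then obtain N where N: "N \<in> Mat2_Z_inv p" "\<And>a. a \<in> A \<Longrightarrow> fst (\<phi> (a, 0)) = N *v a"
    using additive_imp_matrix[of "\<lambda>a. fst (\<phi> (a, 0))"] cl by auto
  define e where "e = snd (\<phi> (0, 1))"
  have plus: "snd (\<phi> (0, h + k)) = snd (\<phi> (0, h)) + snd (\<phi> (0, k))" for h k
    using mult[of 0 0 h k] by (simp add: A_closed \<theta>_at_0)
  have e: "snd (\<phi> (0, k)) = e * k" for k
  proof (induction k rule: int_induct[where k = 0])
    case base
    then show ?case by (simp add: snd0 A_closed)
  next
    case (step1 i)
    then show ?case by (simp add: plus e_def algebra_simps)
  next
    case (step2 i)
    then show ?case using plus[of "i - 1" 1] by (simp add: e_def algebra_simps)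
  qed
  show ?thesis
  proof (rule that[OF N(1)])
    show "\<phi> (a, 0) = (N *v a, 0)" if "a \<in> A" for a
      using N(2) snd0 that by (simp add: prod_eq_iff)
    show "snd (\<phi> (a, k)) = e * k" if "a \<in> A" for a k
      \<comment> \<open>Here \<open>(a, k)\<close> is split as \<open>(a, 0)\<close> times
        \<open>(0, k)\<close>.\<close>
      using mult[of a 0 0 k] that by (simp add: A_closed \<theta>_at_0 snd0 e)
  qed
qed

text \<open>The matrices attached to \<open>\<phi>\<close> and to its inverse are mutually inverse,
  and the two integers multiply to 1.\<close>

lemma auto_G:
  assumes "\<phi> \<in> auto G"
  obtains N e where "N \<in> GL2_Z_inv p" "e = 1 \<or> e = - 1"
    "\<And>a. a \<in> A \<Longrightarrow> \<phi> (a, 0) = (N *v a, 0)" "\<And>a k. a \<in> A \<Longrightarrow> snd (\<phi> (a, k)) = e * k"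
proof -
  from assms have \<phi>: "\<phi> \<in> hom G G" "\<phi> \<in> Bij (carrier G)" by (simp_all add: auto_def)
  then have bij: "bij_betw \<phi> (carrier G) (carrier G)" by (simp add: Bij_def)
  define \<psi> where "\<psi> = restrict (inv_into (carrier G) \<phi>) (carrier G)"
  have \<psi>: "\<psi> \<in> hom G G"
    unfolding \<psi>_def using \<phi> by (rule group.restrict_inv_into_hom[OF group_G])
  have inv: "\<psi> (\<phi> x) = x" "\<phi> (\<psi> x) = x" if "x \<in> carrier G" for x
    using that bij by (simp_all add: \<psi>_def bij_betw_inv_into_left bij_betw_inv_into_right bij_betwE)
  obtain N e where N: "N \<in> Mat2_Z_inv p"
    "\<And>a. a \<in> A \<Longrightarrow> \<phi> (a, 0) = (N *v a, 0)" "\<And>a k. a \<in> A \<Longrightarrow> snd (\<phi> (a, k)) = e * k"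
    using hom_G[OF \<phi>(1)] by blast
  obtain N' e' where N': "N' \<in> Mat2_Z_inv p"
    "\<And>a. a \<in> A \<Longrightarrow> \<psi> (a, 0) = (N' *v a, 0)" "\<And>a k. a \<in> A \<Longrightarrow> snd (\<psi> (a, k)) = e' * k"
    using hom_G[OF \<psi>] by blast
  have "(N' ** N) *v a = mat 1 *v a" if "a \<in> A" for a
    using inv(1)[of "(a, 0)"] that N N' by (simp add: Mat2_mult_vec matrix_vector_mul_assoc)
  then have "N' ** N = mat 1" by (rule matrix_eq_on_A)
  moreover have "(N ** N') *v a = mat 1 *v a" if "a \<in> A" for a
    using inv(2)[of "(a, 0)"] that N N' by (simp add: Mat2_mult_vec matrix_vector_mul_assoc)
  then have "N ** N' = mat 1" by (rule matrix_eq_on_A)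
  ultimately have "N \<in> GL2_Z_inv p" using N(1) N'(1) by (auto simp: GL2_Z_inv_def)
  moreover have "e = 1 \<or> e = - 1"
  proof -
    obtain b l where b: "\<phi> (0, 1) = (b, l)" by (cases "\<phi> (0, 1)")
    then have "b \<in> A" using hom_in_carrier[OF \<phi>(1), of "(0, 1)"] by (simp add: A_closed)
    moreover have "l = e" using N(3)[of 0 1] b by (simp add: A_closed)
    ultimately have "e' * e = 1"
      using inv(1)[of "(0, 1)"] N'(3)[of b l] b by (simp add: A_closed)
    then show ?thesis using zmult_eq_1_iff by auto
  qed
  ultimately show ?thesis using that N(2,3) by blast
qed

section \<open>Consequences of a finite Reidemeister number, and the spectrum\<close>

lemma reidemeister_number_finite_imp:
  assumes \<phi>: "\<phi> \<in> auto G" and fin: "reidemeister_number G \<phi> \<noteq> \<infinity>"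
  obtains N where "N \<in> GL2_Z_inv p" "N = M ** N ** M"
    "det (mat 1 - N) \<noteq> 0" "det (mat 1 - M ** N) \<noteq> 0"
proof -
  obtain N e where N: "N \<in> GL2_Z_inv p" and e: "e = 1 \<or> e = - 1"
    and \<phi>0: "\<And>a. a \<in> A \<Longrightarrow> \<phi> (a, 0) = (N *v a, 0)" and snd: "\<And>a k. a \<in> A \<Longrightarrow> snd (\<phi> (a, k)) = e * k"
    using auto_G[OF \<phi>] by blast
  have hom: "\<phi> \<in> hom G G" using \<phi> by (simp add: auto_def)
  note rel = reidemeister_rel_iff[OF group_G hom]
  have N': "N \<in> Mat2_Z_inv p" using N by (simp add: GL2_Z_inv_def)
  \<comment> \<open>For \<open>e = 1\<close> this makes the integer component a class invariant; for
    \<open>e = - 1\<close> and \<open>k = l\<close> it forces \<open>m = 0\<close>.\<close>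
  have rel_snd: "k + e * m = m + l"
    if "(y, k) \<otimes>\<^bsub>G\<^esub> \<phi> (a, m) = (a, m) \<otimes>\<^bsub>G\<^esub> (x, l)" "a \<in> A" for x y a k l m
    using that snd[of a m] by (cases "\<phi> (a, m)") simp
  have "e \<noteq> 1"
  proof
    assume "e = 1"
    have "reidemeister_number G \<phi> = \<infinity>"
    proof (rule reidemeister_number_eq_infinity[OF group_G hom, of "\<lambda>n. (0, int n)"])
      show "i = j" if "((0, int i), (0, int j)) \<in> reidemeister_rel G \<phi>" for i j
        using that \<open>e = 1\<close> by (auto simp: rel simp del: mult_G dest!: rel_snd)
    qed (auto simp: A_closed)
    with fin show False by contradiction
  qed
  with e have e: "e = - 1" by simp
  have "N *v a = (M ** N ** M) *v a" if a: "a \<in> A" for a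
  proof -
    obtain b where b: "\<phi> (0, 1) = (b, - 1)" "b \<in> A"
      using snd[of 0 1] hom_in_carrier[OF hom, of "(0, 1)"]
      by (cases "\<phi> (0, 1)") (simp add: A_closed e)
    \<comment> \<open>The two products are equal by the defining relation of the semidirect product;
      in their images the unknown \<open>b\<close> cancels.\<close>
    have "\<phi> ((0, 1) \<otimes>\<^bsub>G\<^esub> (a, 0)) = \<phi> ((\<theta> 1 a, 0) \<otimes>\<^bsub>G\<^esub> (0, 1))"
      using a by (simp add: \<theta>_at_0)
    then have "(b, - 1) \<otimes>\<^bsub>G\<^esub> (N *v a, 0) = (N *v \<theta> 1 a, 0) \<otimes>\<^bsub>G\<^esub> (b, - 1)"
      using a b by (simp add: hom_mult[OF hom] \<phi>0 \<theta>_closed A_closed del: mult_G)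
    then have "\<theta> (- 1) (N *v a) = N *v \<theta> 1 a"
      using a b N' by (simp add: \<theta>_0 Mat2_mult_vec)
    then have "\<theta> 1 (\<theta> (- 1) (N *v a)) = \<theta> 1 (N *v \<theta> 1 a)" by simp
    then show ?thesis
      using a N' by (simp add: \<theta>_cancel Mat2_mult_vec \<theta>_1_N_\<theta>_1)
  qed
  then have MNM: "N = M ** N ** M" by (rule matrix_eq_on_A)
  \<comment> \<open>Treats both determinants at once: \<open>B\<close> is \<open>N\<close> for
    \<open>r = 0\<close> and \<open>MN\<close> for \<open>r = 1\<close>.\<close>
  have infinite: "reidemeister_number G \<phi> = \<infinity>"
    if det: "det (mat 1 - B) = 0" and B: "\<And>a. a \<in> A \<Longrightarrow> \<theta> r (N *v a) = B *v a" for B r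
  proof -
    obtain f :: "nat \<Rightarrow> rat ^ 2" where f: "range f \<subseteq> A" "\<And>i j a. f j - f i = (mat 1 - B) *v a \<Longrightarrow> i = j"
      using infinite_cokernel[OF det] by blast
    show ?thesis
    proof (rule reidemeister_number_eq_infinity[OF group_G hom, of "\<lambda>n. (f n, r)"])
      show "range (\<lambda>n. (f n, r)) \<subseteq> carrier G" using f(1) by auto
      fix i j assume "((f i, r), (f j, r)) \<in> reidemeister_rel G \<phi>"
      then obtain a m where a: "a \<in> A" "(f j, r) \<otimes>\<^bsub>G\<^esub> \<phi> (a, m) = (a, m) \<otimes>\<^bsub>G\<^esub> (f i, r)"
        by (auto simp: rel simp del: mult_G)
      \<comment> \<open>The conjugating element lies in \<open>A\<close>, where
        \<open>\<phi>\<close> acts by \<open>N\<close>; thus equivalence over \<open>r\<close> is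
        congruence modulo the image of \<open>1 - B\<close>.\<close>
      with rel_snd[OF a(2,1)] e have "m = 0" by simp
      with a f(1) have "f j + B *v a = a + f i" by (simp add: \<phi>0 B \<theta>_0 image_subset_iff)
      then have "f j - f i = (mat 1 - B) *v a"
        by (simp add: matrix_vector_mult_diff_rdistrib algebra_simps)
      then show "i = j" by (rule f(2))
    qed
  qed
  show ?thesis
  proof (rule that[OF N MNM])
    show "det (mat 1 - N) \<noteq> 0"
      using infinite[of N 0] fin N' by (auto simp: \<theta>_0 Mat2_mult_vec)
    show "det (mat 1 - M ** N) \<noteq> 0"
      using infinite[of "M ** N" 1] fin N' by (auto simp: \<theta>_1 Mat2_mult_vec matrix_vector_mul_assoc)
  qed
qed

lemma spectrum_eq_infinity_iff:
  "reidemeister_spectrum G = {\<infinity>} \<longleftrightarrow>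
    \<not> (\<exists>N\<in>GL2_Z_inv p. N = M ** N ** M \<and> det (mat 1 - N) \<noteq> 0 \<and> det (mat 1 - M ** N) \<noteq> 0)"
proof -
  have "reidemeister_spectrum G = reidemeister_number G ` auto G"
    by (auto simp: reidemeister_spectrum_def)
  \<comment> \<open>The restricted identity is an automorphism, so the spectrum is nonempty and
    equals \<open>{\<infinity>}\<close> as soon as it has no finite member.\<close>
  moreover have "auto G \<noteq> {}"
    using group.id_in_auto[OF group_G] by blast
  ultimately have "reidemeister_spectrum G = {\<infinity>} \<longleftrightarrow> (\<forall>\<phi>\<in>auto G. reidemeister_number G \<phi> = \<infinity>)"
    by (auto intro: rev_image_eqI)
  also have "\<dots> \<longleftrightarrow> \<not> (\<exists>\<phi>\<in>auto G. reidemeister_number G \<phi> \<noteq> \<infinity>)"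
    by simp
  also have "(\<exists>\<phi>\<in>auto G. reidemeister_number G \<phi> \<noteq> \<infinity>) \<longleftrightarrow>
      (\<exists>N\<in>GL2_Z_inv p. N = M ** N ** M \<and> det (mat 1 - N) \<noteq> 0 \<and> det (mat 1 - M ** N) \<noteq> 0)"
  proof
    assume "\<exists>\<phi>\<in>auto G. reidemeister_number G \<phi> \<noteq> \<infinity>"
    then obtain \<phi> where "\<phi> \<in> auto G" "reidemeister_number G \<phi> \<noteq> \<infinity>" ..
    then show "\<exists>N\<in>GL2_Z_inv p. N = M ** N ** M \<and> det (mat 1 - N) \<noteq> 0 \<and> det (mat 1 - M ** N) \<noteq> 0"
      by (rule reidemeister_number_finite_imp) (intro bexI conjI)
  next
    assume "\<exists>N\<in>GL2_Z_inv p. N = M ** N ** M \<and> det (mat 1 - N) \<noteq> 0 \<and> det (mat 1 - M ** N) \<noteq> 0"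
    then obtain N where N: "N \<in> GL2_Z_inv p" "N = M ** N ** M"
      and "det (mat 1 - N) \<noteq> 0" "det (mat 1 - M ** N) \<noteq> 0" by (elim bexE conjE)
    then have "reidemeister_number G (flip_auto N) \<noteq> \<infinity>"
      by (rule reidemeister_number_flip_auto)
    moreover have "flip_auto N \<in> auto G" using N by (rule flip_auto)
    ultimately show "\<exists>\<phi>\<in>auto G. reidemeister_number G \<phi> \<noteq> \<infinity>" by (rule bexI)
  qed
  finally show ?thesis .
qed

end

theorem proposition3p3:
  fixes p :: nat and \<theta> :: "int \<Rightarrow> rat ^ 2 \<Rightarrow> rat ^ 2" and M :: "rat ^ 2 ^ 2"
  assumes "Factorial_Ring.prime p"
    and "\<theta> \<in> hom integer_group (AutoGroup (Z_inv_sq p))"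
    and "M \<in> GL2_Z_inv p"
    and "\<And>v. v \<in> carrier (Z_inv_sq p) \<Longrightarrow> \<theta> 1 v = M *v v"
  shows "reidemeister_spectrum (semidirect_product (Z_inv_sq p) integer_group \<theta>) = {\<infinity>} \<longleftrightarrow>
    \<not> (\<exists>N\<in>GL2_Z_inv p. N = M ** N ** M \<and> det (mat 1 - N) \<noteq> 0 \<and> det (mat 1 - M ** N) \<noteq> 0)"
proof -
  interpret Z_inv_sq_by_Z p \<theta> M
    using assms by unfold_locales
  show ?thesis by (rule spectrum_eq_infinity_iff)
qed

end
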